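(* Let $\mathbf{x}^{(1)},\mathbf{x}^{(2)},\mathbf{x}^{(3)}\in\mathbb{R}^2$, $\mathbf{a}_0\in\mathbb{R}^2$ and $\boldsymbol{\alpha}_0=(\alpha_0^{(1)},\alpha_0^{(2)},\alpha_0^{(3)})\in\mathbb{R}^3$ be given. Assume that for each $i=1,2,3$ $$\left|\sum_{j=1,\ j\ne i}^3\frac{\mathbf{x}^{(j)}-\mathbf{x}^{(i)}}{|\mathbf{x}^{(j)}-\mathbf{x}^{(i)}|}\right|>1,$$ and let $\mathbf{a}_\infty\in\mathbb{R}^2$, $\mathbf{a}_\infty\neq\mathbf{x}^{(j)}$ for $j=1,2,3$, be a solution of $\sum_{j=1}^3\mathbf{b}_\infty^{(j)}/|\mathbf{b}_\infty^{(j)}|=\mathbf{0}$, where $\mathbf{b}_\infty^{(j)}=\mathbf{x}^{(j)}-\mathbf{a}_\infty$. Assume further that $|\mathbf{a}_0-\mathbf{a}_\infty|<\frac12|\mathbf{b}_\infty^{(j)}|$ for all $j=1,2,3$. Then there exists a local in time solution $(\boldsymbol{\alpha},\mathbf{a})$, on an interval $[0,T_{\max})$ with $T_{\max}>0$, of the initial value problem (S) described in the context, such that $$|\mathbf{a}(t)-\mathbf{a}_\infty|<|\mathbf{b}_\infty^{(j)}|\quad\text{for all } j=1,2,3\text{ and } 0\le t<T_{\max}.$$ Furthermore, the maximal existence time $T_{\max}$ of this solution (the supremum of the $T>0$ such that a solution exists on $[0,T)$ and satisfies the displayed bound there) satisfies $$T_{\max}\ge\min\left\{\frac{|\boldsymbol{\alpha}_0|}{4(M_1+8M_2|\boldsymbol{\alpha}_0|)\sum_{j=1}^3|\mathbf{b}_\infty^{(j)}|},\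 \frac{|\mathbf{a}_0-\mathbf{a}_\infty|}{3M_0},\ \frac1{12M_1},\ \frac{1}{8M_0\sum_{j=1}^3\frac1{|\mathbf{b}_\infty^{(j)}|-2|\mathbf{a}_0-\mathbf{a}_\infty|}}\right\},$$ where $$M_0=\sup_{|\theta|\le4|\boldsymbol{\alpha}_0|}|\sigma(\theta)|,\quad M_1=\sup_{|\theta|\le4|\boldsymbol{\alpha}_0|}|\sigma_\theta(\theta)|,\quad M_2=\sup_{|\theta_1|,|\theta_2|\le4|\boldsymbol{\alpha}_0|}\frac{|\sigma_\theta(\theta_1)-\sigma_\theta(\theta_2)|}{|\theta_1-\theta_2|}.$$
   Context: The surface tension $\sigma:\mathbb{R}\to[0,\infty)$ is continuously differentiable with locally Lipschitz derivative $\sigma_\theta=\sigma'$, and satisfies: (i) there is a constant $C_1>0$ with $\sigma(\theta)\ge C_1$ for all $\theta\in\mathbb{R}$; (ii) $\sigma_\theta(\theta)\theta\ge0$ for all $\theta$; (iii) $\sigma_\theta(\theta)=0$ if and only if $\theta=0$. $|\cdot|$ is the Euclidean norm. Superscripts are cyclic modulo 3: $\alpha^{(0)}=\alpha^{(3)}$, $\alpha^{(4)}=\alpha^{(1)}$, etc. The misorientations are $\Delta\alpha^{(j)}=\alpha^{(j-1)}-\alpha^{(j)}$. Problem (S): find $\boldsymbol{\alpha}(t)=(\alpha^{(1)}(t),\alpha^{(2)}(t),\alpha^{(3)}(t))\in\mathbb{R}^3$ and $\mathbf{a}(t)\in\mathbb{R}^2$ such that, with $\mathbf{b}^{(j)}(t)=\mathbf{x}^{(j)}-\mathbf{a}(t)$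 (nonzero for all times considered), $$\frac{d\alpha^{(j)}}{dt}=-\Big(\sigma_\theta(\Delta\alpha^{(j+1)})|\mathbf{b}^{(j+1)}|-\sigma_\theta(\Delta\alpha^{(j)})|\mathbf{b}^{(j)}|\Big),\ j=1,2,3,\qquad \frac{d\mathbf{a}}{dt}=\sum_{j=1}^3\sigma(\Delta\alpha^{(j)})\frac{\mathbf{b}^{(j)}}{|\mathbf{b}^{(j)}|},$$ with $\boldsymbol{\alpha}(0)=\boldsymbol{\alpha}_0$, $\mathbf{a}(0)=\mathbf{a}_0$. Conventions: difference quotients are read as $0$ when $\theta_1=\theta_2$; in the minimum, $1/0=+\infty$ and $0/0=0$. *)

theory Defs
  imports "HOL-Analysis.Analysis"
begin

text \<open>
  The superscripts live in the index type \<open>3\<close>, whose arithmetic is modulo 3 (so \<open>3 = 0\<close>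
  and \<open>j - 1\<close>, \<open>j + 1\<close> are the cyclic neighbours of \<open>j\<close>).
\<close>

definition misorientation :: "real ^ 3 \<Rightarrow> 3 \<Rightarrow> real" where
  "misorientation \<alpha> j = \<alpha> $ (j - 1) - \<alpha> $ j"

text \<open>The half-open interval \<open>[0, T)\<close>, with \<open>T = \<infinity>\<close> allowed.\<close>

definition time_interval :: "ereal \<Rightarrow> real set" where
  "time_interval T = {t. 0 \<le> t \<and> ereal t < T}"

text \<open>
  \<open>(\<alpha>, a)\<close> solves the initial value problem (S) on \<open>[0, T)\<close>; \<open>\<sigma>\<^sub>\<theta>\<close> is the derivative of \<open>\<sigma>\<close>.
  The values of \<open>\<alpha>\<close> and \<open>a\<close> outside \<open>[0, T)\<close> are irrelevant, and the derivative at \<open>t = 0\<close> is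
  one-sided.
\<close>

definition solves_S ::
  "(real \<Rightarrow> real) \<Rightarrow> (real \<Rightarrow> real) \<Rightarrow> (3 \<Rightarrow> real ^ 2) \<Rightarrow> real ^ 3 \<Rightarrow> real ^ 2 \<Rightarrow> ereal \<Rightarrow>
   (real \<Rightarrow> real ^ 3) \<Rightarrow> (real \<Rightarrow> real ^ 2) \<Rightarrow> bool" where
  "solves_S \<sigma> \<sigma>\<^sub>\<theta> x \<alpha>\<^sub>0 a\<^sub>0 T \<alpha> a \<longleftrightarrow>
     \<alpha> 0 = \<alpha>\<^sub>0 \<and> a 0 = a\<^sub>0 \<and>
     (\<forall>t \<in> time_interval T.
        let b = (\<lambda>j. x j - a t); \<Delta> = misorientation (\<alpha> t) in
        (\<forall>j. b j \<noteq> 0) \<and>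
        (\<forall>j. ((\<lambda>s. \<alpha> s $ j) has_real_derivative
                - (\<sigma>\<^sub>\<theta> (\<Delta> (j + 1)) * norm (b (j + 1)) - \<sigma>\<^sub>\<theta> (\<Delta> j) * norm (b j)))
              (at t within time_interval T)) \<and>
        (a has_vector_derivative (\<Sum>j\<in>UNIV. \<sigma> (\<Delta> j) *\<^sub>R (b j /\<^sub>R norm (b j))))
          (at t within time_interval T))"

definition bounded_solution ::
  "(real \<Rightarrow> real) \<Rightarrow> (real \<Rightarrow> real) \<Rightarrow> (3 \<Rightarrow> real ^ 2) \<Rightarrow> real ^ 2 \<Rightarrow> real ^ 3 \<Rightarrow> real ^ 2 \<Rightarrow> ereal \<Rightarrow>
   (real \<Rightarrow> real ^ 3) \<Rightarrow> (real \<Rightarrow> real ^ 2) \<Rightarrow> bool" where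
  "bounded_solution \<sigma> \<sigma>\<^sub>\<theta> x a_inf \<alpha>\<^sub>0 a\<^sub>0 T \<alpha> a \<longleftrightarrow>
     solves_S \<sigma> \<sigma>\<^sub>\<theta> x \<alpha>\<^sub>0 a\<^sub>0 T \<alpha> a \<and>
     (\<forall>t \<in> time_interval T. \<forall>j. norm (a t - a_inf) < norm (x j - a_inf))"

definition max_existence_time ::
  "(real \<Rightarrow> real) \<Rightarrow> (real \<Rightarrow> real) \<Rightarrow> (3 \<Rightarrow> real ^ 2) \<Rightarrow> real ^ 2 \<Rightarrow> real ^ 3 \<Rightarrow> real ^ 2 \<Rightarrow> ereal"
where
  "max_existence_time \<sigma> \<sigma>\<^sub>\<theta> x a_inf \<alpha>\<^sub>0 a\<^sub>0 =
     Sup {T. 0 < T \<and> (\<exists>\<alpha> a. bounded_solution \<sigma> \<sigma>\<^sub>\<theta> x a_inf \<alpha>\<^sub>0 a\<^sub>0 T \<alpha> a)}"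

text \<open>
  Suprema over \<open>[-R, R]\<close> are real-valued: they are finite when \<open>f\<close> is continuous, respectively
  locally Lipschitz. The difference quotient at \<open>\<theta>\<^sub>1 = \<theta>\<^sub>2\<close> is \<open>0 / 0 = 0\<close>.
\<close>

definition sup_abs :: "(real \<Rightarrow> real) \<Rightarrow> real \<Rightarrow> real" where
  "sup_abs f R = (SUP \<theta>\<in>{\<theta>. \<bar>\<theta>\<bar> \<le> R}. \<bar>f \<theta>\<bar>)"

definition sup_diff_quotient :: "(real \<Rightarrow> real) \<Rightarrow> real \<Rightarrow> real" where
  "sup_diff_quotient f R =
     (SUP (\<theta>\<^sub>1, \<theta>\<^sub>2)\<in>{(\<theta>\<^sub>1, \<theta>\<^sub>2). \<bar>\<theta>\<^sub>1\<bar> \<le> R \<and> \<bar>\<theta>\<^sub>2\<bar> \<le> R}. \<bar>f \<theta>\<^sub>1 - f \<theta>\<^sub>2\<bar> / \<bar>\<theta>\<^sub>1 - \<theta>\<^sub>2\<bar>)"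

text \<open>
  The outer quotients are taken in \<open>ereal\<close>, where \<open>1 / 0 = \<infinity>\<close> and \<open>0 / 0 = 0\<close>.
\<close>

definition existence_time_bound ::
  "(real \<Rightarrow> real) \<Rightarrow> (real \<Rightarrow> real) \<Rightarrow> (3 \<Rightarrow> real ^ 2) \<Rightarrow> real ^ 2 \<Rightarrow> real ^ 3 \<Rightarrow> real ^ 2 \<Rightarrow> ereal"
where
  "existence_time_bound \<sigma> \<sigma>\<^sub>\<theta> x a_inf \<alpha>\<^sub>0 a\<^sub>0 =
     (let M\<^sub>0 = sup_abs \<sigma> (4 * norm \<alpha>\<^sub>0);
          M\<^sub>1 = sup_abs \<sigma>\<^sub>\<theta> (4 * norm \<alpha>\<^sub>0);
          M\<^sub>2 = sup_diff_quotient \<sigma>\<^sub>\<theta> (4 * norm \<alpha>\<^sub>0);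
          b_inf = (\<lambda>j. x j - a_inf)
      in Min {ereal (norm \<alpha>\<^sub>0) /
                ereal (4 * (M\<^sub>1 + 8 * M\<^sub>2 * norm \<alpha>\<^sub>0) * (\<Sum>j\<in>UNIV. norm (b_inf j))),
              ereal (norm (a\<^sub>0 - a_inf)) / ereal (3 * M\<^sub>0),
              1 / ereal (12 * M\<^sub>1),
              1 / ereal (8 * M\<^sub>0 *
                (\<Sum>j\<in>UNIV. 1 / (norm (b_inf j) - 2 * norm (a\<^sub>0 - a_inf))))})"

end

theory Submission
  imports Defs
begin

text \<open>
  On the product \<open>K\<close> of closed balls around \<open>\<alpha>\<^sub>0\<close> and \<open>a\<^sub>0\<close> the right-hand side of (S) is Lipschitz,
  and its two components are bounded by \<open>4 M\<^sub>1 \<Sum>\<^sub>j |b\<^sub>\<infinity>\<^sup>j|\<close> and \<open>3 M\<^sub>0\<close>. A solution of the system whose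
  argument is projected to \<open>K\<close> exists for all times, by a contraction in an exponentially weighted
  supremum norm, and it cannot leave \<open>K\<close> as long as these speeds times \<open>t\<close> do not exceed the radii.
  With radii \<open>|\<alpha>\<^sub>0|\<close> and \<open>|a\<^sub>0 - a\<^sub>\<infinity>|\<close> this covers the minimum of the first two terms of the claimed
  bound; when one of the radii vanishes, the bound is \<open>0\<close> and any positive radii do. Solutions are
  unique by Gronwall's inequality, so they glue to a solution on the maximal interval.
\<close>

section \<open>Uniqueness and global existence for Lipschitz vector fields\<close>

text \<open>By Cauchy-Schwarz the squared distance of the two solutions has derivative at most 2 L
  times itself, so after multiplication by exp (- 2 L t) it is nonincreasing. It starts at 0 and
  therefore vanishes at \<open>s\<close>.\<close>

lemma ode_unique:
  fixes F :: "'a::real_inner \<Rightarrow> 'a"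
  assumes lip: "L-lipschitz_on K F"
    and K: "\<And>t. t \<in> {0..s} \<Longrightarrow> u t \<in> K" "\<And>t. t \<in> {0..s} \<Longrightarrow> v t \<in> K"
    and u: "\<And>t. t \<in> {0..s} \<Longrightarrow> (u has_vector_derivative F (u t)) (at t within {0..s})"
    and v: "\<And>t. t \<in> {0..s} \<Longrightarrow> (v has_vector_derivative F (v t)) (at t within {0..s})"
    and init: "u 0 = v 0" and s: "0 \<le> s"
  shows "u s = v s"
proof -
  define g where "g = (\<lambda>t. exp (- (2 * L) * t) * ((u t - v t) \<bullet> (u t - v t)))"
  define g' where "g' = (\<lambda>t. exp (- (2 * L) * t) * (2 * ((u t - v t) \<bullet> (F (u t) - F (v t))))
      - 2 * L * exp (- (2 * L) * t) * ((u t - v t) \<bullet> (u t - v t)))"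
  have deriv: "(g has_real_derivative g' t) (at t within {0..s})" if "t \<in> {0..s}" for t
  proof -
    have d: "((\<lambda>t. u t - v t) has_vector_derivative F (u t) - F (v t)) (at t within {0..s})"
      by (intro has_vector_derivative_diff u v that)
    have D: "((\<lambda>t. (u t - v t) \<bullet> (u t - v t)) has_real_derivative
        2 * ((u t - v t) \<bullet> (F (u t) - F (v t)))) (at t within {0..s})"
      using has_derivative_inner[OF d[unfolded has_vector_derivative_def] d[unfolded has_vector_derivative_def]]
      unfolding has_field_derivative_def
      by (rule has_derivative_eq_rhs) (auto simp: inner_commute algebra_simps)
    have E: "((\<lambda>t. exp (- (2 * L) * t)) has_real_derivative - (2 * L) * exp (- (2 * L) * t)) (at t within {0..s})"
      by (auto intro!: derivative_eq_intros)
    show ?thesis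
      unfolding g_def g'_def
      by (rule DERIV_cong[OF DERIV_mult[OF E D]]) (simp add: algebra_simps)
  qed
  have nonpos: "g' t \<le> 0" if "t \<in> {0..s}" for t
  proof -
    have "(u t - v t) \<bullet> (F (u t) - F (v t)) \<le> norm (u t - v t) * norm (F (u t) - F (v t))"
      by (rule norm_cauchy_schwarz)
    also have "\<dots> \<le> norm (u t - v t) * (L * norm (u t - v t))"
      using lipschitz_on_normD[OF lip K(1)[OF that] K(2)[OF that]]
      by (intro mult_left_mono) auto
    also have "\<dots> = L * ((u t - v t) \<bullet> (u t - v t))"
      by (simp add: dot_square_norm power2_eq_square)
    finally have "exp (- (2 * L) * t) * (2 * ((u t - v t) \<bullet> (F (u t) - F (v t))))
        \<le> exp (- (2 * L) * t) * (2 * (L * ((u t - v t) \<bullet> (u t - v t))))"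
      by (intro mult_left_mono) auto
    then show ?thesis by (simp add: g'_def algebra_simps)
  qed
  have "g s \<le> g 0"
  proof (rule DERIV_nonpos_imp_decreasing_open[OF s])
    show "\<exists>y. (g has_real_derivative y) (at t) \<and> y \<le> 0" if "0 < t" "t < s" for t
      using deriv[of t] nonpos[of t] that by (auto simp: at_within_Icc_at)
    show "continuous_on {0..s} g"
      using deriv by (rule DERIV_continuous_on)
  qed
  then have "(u s - v s) \<bullet> (u s - v s) \<le> 0"
    by (simp add: g_def init mult_le_0_iff)
  then have "(u s - v s) \<bullet> (u s - v s) = 0"
    by (intro antisym inner_ge_zero)
  then show ?thesis by (simp only: inner_eq_zero_iff right_minus_eq)
qed

text \<open>The unknown of the fixed point problem is the rescaled function w t = exp (- k t) u t.
  In the supremum norm of \<open>w\<close> the Picard map has contraction factor L / k whatever the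
  length of the interval, so no short-time steps have to be patched together.\<close>

lemma global_picard:
  fixes F :: "'a::euclidean_space \<Rightarrow> 'a"
  assumes lip: "L-lipschitz_on UNIV F" and T: "0 \<le> T"
  obtains u where "u 0 = u0"
    "\<And>t. t \<in> {0..T} \<Longrightarrow> (u has_vector_derivative F (u t)) (at t within {0..T})"
proof -
  have L: "0 \<le> L" using lip by (rule lipschitz_on_nonneg)
  \<comment> \<open>This makes L / k less than 1, and keeps \<open>k\<close> positive even when L =
    0.\<close>
  define k where "k = 2 * L + 1"
  have k: "k > 0" "L / k < 1" using L by (auto simp: k_def)
  \<comment> \<open>\<open>J w\<close> is the Picard integral of the unscaled function exp (k r) w
    r, and \<open>P w\<close> is its rescaling. Clamping time to [0, T] by \<open>c\<close> makes
    \<open>P w\<close> a bounded continuous function on the whole line, as the type of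
    \<open>w\<close> requires.\<close>
  define J where "J = (\<lambda>(w :: real \<Rightarrow>\<^sub>C 'a) t. u0 + integral {0..t} (\<lambda>r. F (exp (k * r) *\<^sub>R w r)))"
  define c where "c = (\<lambda>t. max 0 (min T t))"
  define P where "P = (\<lambda>w t. exp (- k * c t) *\<^sub>R J w (c t))"
  have c_in: "c t \<in> {0..T}" for t using T by (auto simp: c_def)
  have cF: "continuous_on S F" for S
    using lipschitz_on_continuous_on[OF lip] by (rule continuous_on_subset) simp
  have contF: "continuous_on S (\<lambda>r. F (exp (k * r) *\<^sub>R apply_bcontfun w r))" for S w
    by (rule continuous_on_compose2[OF cF[of UNIV]]) (auto intro!: continuous_intros)
  have J_deriv: "(J w has_vector_derivative F (exp (k * t) *\<^sub>R w t)) (at t within {0..T})"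
    if "t \<in> {0..T}" for w t
    unfolding J_def using integral_has_vector_derivative[OF contF that, of w]
    by (auto intro!: derivative_eq_intros)
  have "P w \<in> bcontfun" for w
  proof -
    have J: "continuous_on {0..T} (J w)"
      by (rule continuous_on_vector_derivative) (rule J_deriv)
    have e: "continuous_on {0..T} (\<lambda>t. exp (- k * t) *\<^sub>R J w t)"
      by (intro continuous_intros J)
    have "continuous_on UNIV (P w)"
      unfolding P_def by (rule continuous_on_compose2[OF e]) (use c_in in \<open>auto simp: c_def intro!: continuous_intros\<close>)
    moreover have "bounded (range (P w))"
      by (rule bounded_subset[OF compact_imp_bounded[OF compact_continuous_image[OF e compact_Icc]]])
        (use c_in in \<open>auto simp: P_def image_iff\<close>)
    ultimately show ?thesis by (simp add: bcontfun_def)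
  qed
  then have app: "apply_bcontfun (Bcontfun (P w)) = P w" for w
    by (rule Bcontfun_inverse)
  have contr: "dist (Bcontfun (P v)) (Bcontfun (P w)) \<le> L / k * dist v w" for v w
  proof (rule dist_bound)
    fix t
    define s where "s = c t"
    have s: "0 \<le> s" using c_in[of t] by (simp add: s_def)
    let ?V = "\<lambda>r. F (exp (k * r) *\<^sub>R v r)" and ?W = "\<lambda>r. F (exp (k * r) *\<^sub>R w r)"
    have exp_int: "((\<lambda>r. exp (k * r)) has_integral (exp (k * s) / k - exp (k * 0) / k)) {0..s}"
      using s k by (intro fundamental_theorem_of_calculus)
        (auto intro!: derivative_eq_intros simp: has_real_derivative_iff_has_vector_derivative[symmetric])
    have "norm (integral {0..s} (\<lambda>r. ?V r - ?W r)) \<le> integral {0..s} (\<lambda>r. L * dist v w * exp (k * r))"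
    proof (rule integral_norm_bound_integral)
      show "(\<lambda>r. ?V r - ?W r) integrable_on {0..s}"
        by (intro integrable_continuous_real continuous_intros contF)
      show "(\<lambda>r. L * dist v w * exp (k * r)) integrable_on {0..s}"
        by (intro integrable_continuous_real continuous_intros)
      fix r
      have "norm (?V r - ?W r) \<le> L * norm (exp (k * r) *\<^sub>R v r - exp (k * r) *\<^sub>R w r)"
        using lip by (rule lipschitz_on_normD) auto
      also have "\<dots> = L * (exp (k * r) * dist (v r) (w r))"
        by (simp add: dist_norm flip: scaleR_diff_right)
      also have "\<dots> \<le> L * (exp (k * r) * dist v w)"
        by (intro mult_left_mono dist_bounded L) auto
      finally show "norm (?V r - ?W r) \<le> L * dist v w * exp (k * r)" by (simp add: algebra_simps)
    qed
    also have "\<dots> = L * dist v w * ((exp (k * s) - 1) / k)"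
      using integral_unique[OF exp_int] by (simp add: diff_divide_distrib)
    \<comment> \<open>The growth exp (k s) / k of the integrated weight cancels against the factor
      exp (- k s) in \<open>P\<close>; what is left is L / k.\<close>
    also have "\<dots> \<le> L * dist v w * (exp (k * s) / k)"
      using L k by (intro mult_left_mono divide_right_mono) auto
    finally have le: "norm (integral {0..s} (\<lambda>r. ?V r - ?W r)) \<le> L * dist v w * (exp (k * s) / k)" .
    have "dist (P v t) (P w t) = exp (- k * s) * norm (integral {0..s} (\<lambda>r. ?V r - ?W r))"
      unfolding P_def J_def s_def[symmetric]
      by (subst integral_diff) (auto intro!: integrable_continuous_real contF simp: dist_norm simp flip: scaleR_diff_right)
    also have "\<dots> \<le> exp (- k * s) * (L * dist v w * (exp (k * s) / k))"
      by (intro mult_left_mono le) auto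
    also have "\<dots> = L / k * dist v w"
      by (simp add: exp_minus field_simps)
    finally show "dist (apply_bcontfun (Bcontfun (P v)) t) (apply_bcontfun (Bcontfun (P w)) t) \<le> L / k * dist v w"
      by (simp add: app)
  qed
  have "\<exists>!w. Bcontfun (P w) = w"
    by (rule banach_fix_type[of "L / k"]) (use L k contr in auto)
  then obtain w where w: "Bcontfun (P w) = w" by blast
  \<comment> \<open>On [0, T] the clamp is the identity, so undoing the weight in the fixed point
    equation yields the integral equation for \<open>J w\<close>.\<close>
  have fixed: "exp (k * t) *\<^sub>R w t = J w t" if "t \<in> {0..T}" for t
  proof -
    have "c t = t" using that by (auto simp: c_def)
    then have "w t = exp (- k * t) *\<^sub>R J w t"
      using fun_cong[OF app[of w, unfolded w], of t] by (simp add: P_def)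
    then have "exp (k * t) *\<^sub>R w t = (exp (k * t) * exp (- k * t)) *\<^sub>R J w t"
      by (simp only: scaleR_scaleR)
    then show ?thesis by (simp add: exp_minus)
  qed
  show ?thesis
  proof
    show "J w 0 = u0" by (simp add: J_def)
    show "(J w has_vector_derivative F (J w t)) (at t within {0..T})" if "t \<in> {0..T}" for t
      using J_deriv[OF that, of w] fixed[OF that] by simp
  qed
qed

text \<open>Replacing \<open>F\<close> by \<open>F \<circ> closest_point K\<close> makes the field globally Lipschitz without
  enlarging its range, so bounds of \<open>F\<close> on \<open>K\<close> control the solution before it is known to
  stay in \<open>K\<close>.\<close>

lemma projected_picard:
  fixes F :: "'a::euclidean_space \<Rightarrow> 'a"
  assumes lip: "L-lipschitz_on K F" and K: "convex K" "closed K" "K \<noteq> {}" and T: "0 \<le> T"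
  obtains u where "u 0 = u0"
    "\<And>t. t \<in> {0..T} \<Longrightarrow> (u has_vector_derivative F (closest_point K (u t))) (at t within {0..T})"
proof (rule global_picard[OF _ T])
  show "L-lipschitz_on UNIV (\<lambda>p. F (closest_point K p))"
  proof (rule lipschitz_onI)
    fix p q
    have "dist (F (closest_point K p)) (F (closest_point K q)) \<le> L * dist (closest_point K p) (closest_point K q)"
      using K by (intro lipschitz_onD[OF lip] closest_point_in_set)
    also have "\<dots> \<le> L * dist p q"
      by (intro mult_left_mono closest_point_lipschitz K lipschitz_on_nonneg[OF lip])
    finally show "dist (F (closest_point K p)) (F (closest_point K q)) \<le> L * dist p q" .
  qed (rule lipschitz_on_nonneg[OF lip])
qed (use that in blast)

lemma norm_increment_le:
  fixes u :: "real \<Rightarrow> 'a::real_normed_vector"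
  assumes "\<And>t. t \<in> {0..T} \<Longrightarrow> (u has_vector_derivative u' t) (at t within {0..T})"
    and B: "\<And>t. t \<in> {0..T} \<Longrightarrow> norm (u' t) \<le> B" and t: "t \<in> {0..T}"
  shows "norm (u t - u 0) \<le> B * t"
proof -
  have "norm (u t - u 0) \<le> B * norm (t - 0)"
  proof (rule differentiable_bound[where f' = "\<lambda>t h. h *\<^sub>R u' t"])
    show "onorm (\<lambda>h. h *\<^sub>R u' s) \<le> B" if "s \<in> {0..T}" for s
      using mult_left_mono[OF B[OF that] abs_ge_zero] by (intro onorm_le) (simp add: mult.commute)
  qed (use assms in \<open>auto simp: has_vector_derivative_def\<close>)
  then show ?thesis using t by simp
qed

section \<open>Lipschitz calculus on compact sets\<close>

text \<open>Compactness bounds both factors, and the difference of products splits as f p (g p - g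
  q) + (f p - f q) g q.\<close>

lemma lipschitz_on_scaleR_compact:
  fixes f :: "'a::metric_space \<Rightarrow> real" and g :: "'a \<Rightarrow> 'b::real_normed_vector"
  assumes "compact K" and f: "L-lipschitz_on K f" and g: "M-lipschitz_on K g"
  shows "\<exists>C. C-lipschitz_on K (\<lambda>p. f p *\<^sub>R g p)"
proof -
  have "bounded (f ` K)" "bounded (g ` K)"
    using assms by (auto intro!: compact_imp_bounded compact_continuous_image lipschitz_on_continuous_on)
  then obtain A B where A: "A > 0" "\<And>p. p \<in> K \<Longrightarrow> norm (f p) \<le> A"
    and B: "B > 0" "\<And>p. p \<in> K \<Longrightarrow> norm (g p) \<le> B"
    unfolding bounded_pos by (metis imageI)
  have L: "L \<ge> 0" "M \<ge> 0" using f g by (auto dest: lipschitz_on_nonneg)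
  have "(A * M + L * B)-lipschitz_on K (\<lambda>p. f p *\<^sub>R g p)"
  proof (rule lipschitz_onI)
    fix p q assume pq: "p \<in> K" "q \<in> K"
    have "dist (f p *\<^sub>R g p) (f q *\<^sub>R g q) = norm (f p *\<^sub>R (g p - g q) + (f p - f q) *\<^sub>R g q)"
      by (simp add: dist_norm algebra_simps)
    also have "\<dots> \<le> norm (f p) * norm (g p - g q) + norm (f p - f q) * norm (g q)"
      by (metis norm_triangle_ineq norm_scaleR real_norm_def)
    also have "\<dots> \<le> A * (M * dist p q) + (L * dist p q) * B"
      using A B L pq lipschitz_onD[OF f pq] lipschitz_onD[OF g pq]
      by (intro add_mono mult_mono) (auto simp: dist_norm)
    finally show "dist (f p *\<^sub>R g p) (f q *\<^sub>R g q) \<le> (A * M + L * B) * dist p q"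
      by (simp add: algebra_simps)
  qed (use A B L in auto)
  then show ?thesis by blast
qed

text \<open>The outer function is only locally Lipschitz, expressed through compact subsets of
  \<open>S\<close>; the compact image of \<open>K\<close> is one of them. With \<open>S\<close> the
  whole line this serves \<sigma> and its derivative, with \<open>S\<close> the positive half-line
  it serves the reciprocal.\<close>

lemma lipschitz_on_compose_compact:
  assumes "compact K" and f: "L-lipschitz_on K f" and "f ` K \<subseteq> S"
    and h: "\<And>C. compact C \<Longrightarrow> C \<subseteq> S \<Longrightarrow> \<exists>M. M-lipschitz_on C h"
  shows "\<exists>M. M-lipschitz_on K (\<lambda>p. h (f p))"
proof -
  have "compact (f ` K)"
    using assms by (auto intro!: compact_continuous_image lipschitz_on_continuous_on)
  then obtain M where "M-lipschitz_on (f ` K) h" using h assms by blast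
  then have "(M * L)-lipschitz_on K (\<lambda>p. h (f p))" using f by (intro lipschitz_on_compose2)
  then show ?thesis by blast
qed

text \<open>A nonempty \<open>C\<close> has a least element m > 0, and the difference of reciprocals
  is the difference of the points divided by s t, where s t is at least m squared.\<close>

lemma lipschitz_on_inverse_compact:
  assumes "compact C" "C \<subseteq> {0<..}"
  shows "\<exists>M. M-lipschitz_on C (inverse :: real \<Rightarrow> real)"
proof (cases "C = {}")
  case False
  then obtain m where m: "m \<in> C" "\<And>s. s \<in> C \<Longrightarrow> m \<le> s"
    using compact_attains_inf[OF assms(1)] by blast
  then have "m > 0" using assms by auto
  have "(inverse (m * m))-lipschitz_on C inverse"
  proof (rule lipschitz_onI)
    fix s t assume st: "s \<in> C" "t \<in> C"
    then have pos: "s > 0" "t > 0" using assms by auto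
    have "dist (inverse s) (inverse t) = inverse (s * t) * dist s t"
      using pos by (simp add: dist_real_def inverse_diff_inverse abs_mult)
    also have "\<dots> \<le> inverse (m * m) * dist s t"
      using m st pos \<open>m > 0\<close> by (intro mult_right_mono le_imp_inverse_le mult_mono) auto
    finally show "dist (inverse s) (inverse t) \<le> inverse (m * m) * dist s t" .
  qed (use \<open>m > 0\<close> in auto)
  then show ?thesis by blast
qed auto

lemma lipschitz_on_sum_ex:
  assumes "finite I" "\<And>i. i \<in> I \<Longrightarrow> \<exists>C. C-lipschitz_on K (f i)"
  shows "\<exists>C. C-lipschitz_on K (\<lambda>p. \<Sum>i\<in>I. f i p :: 'b::real_normed_vector)"
  using assms
proof (induction I rule: finite_induct)
  case empty
  then show ?case by (auto intro: lipschitz_on_constant)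
next
  case (insert i I)
  then obtain C D where "C-lipschitz_on K (f i)" "D-lipschitz_on K (\<lambda>p. \<Sum>i\<in>I. f i p)"
    by blast
  then show ?case using insert.hyps lipschitz_on_add by (simp, blast)
qed

text \<open>The Euclidean norm is at most the sum of the absolute coordinates, so the coordinate
  constants add up.\<close>

lemma lipschitz_on_vec_lambda:
  fixes f :: "'a::metric_space \<Rightarrow> 'n::finite \<Rightarrow> real"
  assumes "\<And>i. \<exists>C. C-lipschitz_on K (\<lambda>p. f p i)"
  shows "\<exists>C. C-lipschitz_on K (\<lambda>p. \<chi> i. f p i)"
proof -
  obtain C where C: "\<And>i. (C i)-lipschitz_on K (\<lambda>p. f p i)" using assms by metis
  have "(\<Sum>i\<in>UNIV. C i)-lipschitz_on K (\<lambda>p. \<chi> i. f p i)"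
  proof (rule lipschitz_onI)
    fix p q assume "p \<in> K" "q \<in> K"
    then have "\<bar>f p i - f q i\<bar> \<le> C i * dist p q" for i
      using lipschitz_onD[OF C] by (simp add: dist_real_def)
    then have "(\<Sum>i\<in>UNIV. \<bar>f p i - f q i\<bar>) \<le> (\<Sum>i\<in>UNIV. C i * dist p q)"
      by (rule sum_mono)
    then show "dist (\<chi> i. f p i) (\<chi> i. f q i) \<le> (\<Sum>i\<in>UNIV. C i) * dist p q"
      using norm_le_l1_cart[of "(\<chi> i. f p i) - (\<chi> i. f q i)"]
      by (simp add: dist_norm sum_distrib_right)
  qed (auto intro!: sum_nonneg lipschitz_on_nonneg[OF C])
  then show ?thesis by blast
qed

lemma lipschitz_on_compact_deriv:
  fixes f :: "real \<Rightarrow> real"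
  assumes deriv: "\<And>t. (f has_real_derivative f' t) (at t)" and cont: "continuous_on UNIV f'"
    and "compact C"
  shows "\<exists>M. M-lipschitz_on C f"
proof -
  \<comment> \<open>The mean value estimate needs a convex domain, so \<open>C\<close> is enlarged
    to a compact interval, on which the continuous derivative is bounded.\<close>
  obtain a b where ab: "C \<subseteq> {a..b}"
    using compact_imp_bounded[OF assms(3)] bounded_subset_cbox_symmetric by (metis cbox_interval)
  have "bounded (f' ` {a..b})"
    by (intro compact_imp_bounded compact_continuous_image continuous_on_subset[OF cont]) auto
  then obtain B where B: "B > 0" "\<And>t. t \<in> {a..b} \<Longrightarrow> norm (f' t) \<le> B"
    unfolding bounded_pos by (metis imageI)
  have "B-lipschitz_on {a..b} f"
  proof (rule lipschitz_onI)
    show "dist (f s) (f t) \<le> B * dist s t" if "s \<in> {a..b}" "t \<in> {a..b}" for s t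
      unfolding dist_norm using B that
      by (intro field_differentiable_bound[of "{a..b}" f f'] DERIV_subset[OF deriv]) auto
  qed (use B in simp)
  then show ?thesis using lipschitz_on_subset ab by blast
qed

section \<open>The vector field of (S) on the product space\<close>

text \<open>Pairing the orientations with the junction turns (S) into a single autonomous equation.
  At a = x j the normalised vector takes the default value 0, so these points are excluded
  separately wherever the field has to be Lipschitz.\<close>

definition S_field ::
  "(real \<Rightarrow> real) \<Rightarrow> (real \<Rightarrow> real) \<Rightarrow> (3 \<Rightarrow> real ^ 2) \<Rightarrow> (real ^ 3) \<times> (real ^ 2) \<Rightarrow> (real ^ 3) \<times> (real ^ 2)" where
  "S_field \<sigma> \<sigma>\<^sub>\<theta> x = (\<lambda>(\<alpha>, a).
     (\<chi> j. - (\<sigma>\<^sub>\<theta> (misorientation \<alpha> (j + 1)) * norm (x (j + 1) - a)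
              - \<sigma>\<^sub>\<theta> (misorientation \<alpha> j) * norm (x j - a)),
      \<Sum>j\<in>UNIV. \<sigma> (misorientation \<alpha> j) *\<^sub>R ((x j - a) /\<^sub>R norm (x j - a))))"

lemma has_vector_derivative_vec:
  fixes f :: "real \<Rightarrow> real ^ 'n"
  shows "(f has_vector_derivative f') (at t within S) \<longleftrightarrow>
    (\<forall>i. ((\<lambda>s. f s $ i) has_real_derivative f' $ i) (at t within S))"
proof -
  have B: "(Basis :: (real ^ 'n) set) = range (\<lambda>i. axis i 1)"
    by (auto simp: Basis_vec_def)
  show ?thesis
    unfolding has_vector_derivative_def has_field_derivative_def
      has_derivative_componentwise_within[of f] B
    by (simp add: inner_axis mult_commute_abs)
qed

lemma has_vector_derivative_Pair_iff:
  "((\<lambda>s. (f s, g s)) has_vector_derivative (f', g')) (at t within S) \<longleftrightarrow>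
    (f has_vector_derivative f') (at t within S) \<and> (g has_vector_derivative g') (at t within S)"
  using bounded_linear.has_vector_derivative[OF bounded_linear_fst, of "\<lambda>s. (f s, g s)"]
    bounded_linear.has_vector_derivative[OF bounded_linear_snd, of "\<lambda>s. (f s, g s)"]
  by (auto intro: has_vector_derivative_Pair)

text \<open>Lets the general results on autonomous equations apply to (S); the componentwise
  derivatives of the orientations merge with that of the junction.\<close>

lemma solves_S_iff:
  "solves_S \<sigma> \<sigma>\<^sub>\<theta> x \<alpha>\<^sub>0 a\<^sub>0 T \<alpha> a \<longleftrightarrow>
    \<alpha> 0 = \<alpha>\<^sub>0 \<and> a 0 = a\<^sub>0 \<and> (\<forall>t \<in> time_interval T. a t \<notin> range x \<and>
      ((\<lambda>s. (\<alpha> s, a s)) has_vector_derivative S_field \<sigma> \<sigma>\<^sub>\<theta> x (\<alpha> t, a t)) (at t within time_interval T))"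
proof -
  have "(\<forall>j. x j - a t \<noteq> 0) \<longleftrightarrow> a t \<notin> range x" for t
    by (metis rangeE rangeI right_minus_eq)
  then show ?thesis
    by (simp only: solves_S_def S_field_def Let_def split_conv has_vector_derivative_Pair_iff
        has_vector_derivative_vec vec_lambda_beta)
qed

text \<open>The field is assembled from affine maps, norms, \<sigma>, its derivative and reciprocals
  of norms by sums, products and compositions. The singularities at x j matter only for the
  reciprocals, where \<open>away\<close> keeps the norms positive.\<close>

lemma S_field_lipschitz:
  assumes \<sigma>: "\<And>C. compact C \<Longrightarrow> \<exists>M. M-lipschitz_on C \<sigma>"
    and \<sigma>\<^sub>\<theta>: "\<And>C. compact C \<Longrightarrow> \<exists>M. M-lipschitz_on C \<sigma>\<^sub>\<theta>"
    and K: "compact K" and away: "\<And>p. p \<in> K \<Longrightarrow> snd p \<notin> range x"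
  shows "\<exists>L. L-lipschitz_on K (S_field \<sigma> \<sigma>\<^sub>\<theta> x)"
proof -
  have bl: "\<exists>L. L-lipschitz_on K f" if "bounded_linear f" for f :: "(real ^ 3) \<times> (real ^ 2) \<Rightarrow> 'c::real_normed_vector"
    using bounded_linear.lipschitz_boundE[OF that, of K] by metis
  have blD: "bounded_linear (\<lambda>p :: (real ^ 3) \<times> (real ^ 2). misorientation (fst p) j)" for j
    unfolding misorientation_def
    by (intro bounded_linear_sub bounded_linear_compose[OF bounded_linear_vec_nth bounded_linear_fst])
  have "\<forall>j. \<exists>L. L-lipschitz_on K (\<lambda>p. misorientation (fst p) j)"
    by (intro allI bl blD)
  then obtain D where D: "\<And>j. (D j)-lipschitz_on K (\<lambda>p. misorientation (fst p) j)"
    unfolding choice_iff by blast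
  have lin: "1-lipschitz_on K (\<lambda>p. x j - snd p)" for j
  proof (rule lipschitz_onI)
    show "dist (x j - snd p) (x j - snd q) \<le> 1 * dist p q" for p q :: "(real ^ 3) \<times> (real ^ 2)"
      using dist_snd_le[of p q] by (simp add: dist_norm norm_minus_commute)
  qed simp
  have nrm: "1-lipschitz_on K (\<lambda>p. norm (x j - snd p))" for j
  proof (rule lipschitz_onI)
    fix p q :: "(real ^ 3) \<times> (real ^ 2)" assume "p \<in> K" "q \<in> K"
    then show "dist (norm (x j - snd p)) (norm (x j - snd q)) \<le> 1 * dist p q"
      using lipschitz_onD[OF lin[of j], of p q] norm_triangle_ineq3[of "x j - snd p" "x j - snd q"]
      by (simp add: dist_norm)
  qed simp
  have unit: "\<exists>L. L-lipschitz_on K (\<lambda>p. inverse (norm (x j - snd p)) *\<^sub>R (x j - snd p))" for j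
  proof -
    have "\<exists>L. L-lipschitz_on K (\<lambda>p. inverse (norm (x j - snd p)))"
    proof (rule lipschitz_on_compose_compact[OF K nrm[of j] _ lipschitz_on_inverse_compact])
      show "(\<lambda>p. norm (x j - snd p)) ` K \<subseteq> {0<..}"
        using away by (auto simp: image_subset_iff) (metis rangeI)
    qed
    then obtain L where L: "L-lipschitz_on K (\<lambda>p. inverse (norm (x j - snd p)))" ..
    show ?thesis by (rule lipschitz_on_scaleR_compact[OF K L lin])
  qed
  have s: "\<exists>L. L-lipschitz_on K (\<lambda>p. \<sigma> (misorientation (fst p) j))" for j
    by (rule lipschitz_on_compose_compact[OF K D subset_UNIV \<sigma>])
  have s': "\<exists>L. L-lipschitz_on K (\<lambda>p. \<sigma>\<^sub>\<theta> (misorientation (fst p) j))" for j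
    by (rule lipschitz_on_compose_compact[OF K D subset_UNIV \<sigma>\<^sub>\<theta>])
  have a: "\<exists>L. L-lipschitz_on K (\<lambda>p. \<sigma>\<^sub>\<theta> (misorientation (fst p) j) * norm (x j - snd p))" for j
  proof -
    obtain L where "L-lipschitz_on K (\<lambda>p. \<sigma>\<^sub>\<theta> (misorientation (fst p) j))" using s' ..
    from lipschitz_on_scaleR_compact[OF K this nrm] show ?thesis by simp
  qed
  have "\<exists>L. L-lipschitz_on K (\<lambda>p. - (\<sigma>\<^sub>\<theta> (misorientation (fst p) (j + 1)) * norm (x (j + 1) - snd p)
      - \<sigma>\<^sub>\<theta> (misorientation (fst p) j) * norm (x j - snd p)))" for j
  proof -
    obtain L M where "L-lipschitz_on K (\<lambda>p. \<sigma>\<^sub>\<theta> (misorientation (fst p) (j + 1)) * norm (x (j + 1) - snd p))"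
      "M-lipschitz_on K (\<lambda>p. \<sigma>\<^sub>\<theta> (misorientation (fst p) j) * norm (x j - snd p))"
      using a[of "j + 1"] a[of j] by (elim exE)
    from lipschitz_on_minus[OF lipschitz_on_diff[OF this]] show ?thesis by (rule exI)
  qed
  then have 1: "\<exists>L. L-lipschitz_on K (\<lambda>p. \<chi> j. - (\<sigma>\<^sub>\<theta> (misorientation (fst p) (j + 1)) * norm (x (j + 1) - snd p)
      - \<sigma>\<^sub>\<theta> (misorientation (fst p) j) * norm (x j - snd p)))"
    by (rule lipschitz_on_vec_lambda)
  have 2: "\<exists>L. L-lipschitz_on K (\<lambda>p. \<Sum>j\<in>UNIV. \<sigma> (misorientation (fst p) j) *\<^sub>R ((x j - snd p) /\<^sub>R norm (x j - snd p)))"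
  proof (rule lipschitz_on_sum_ex)
    fix j :: 3
    obtain L M where "L-lipschitz_on K (\<lambda>p. \<sigma> (misorientation (fst p) j))"
      "M-lipschitz_on K (\<lambda>p. (x j - snd p) /\<^sub>R norm (x j - snd p))"
      using s[of j] unit[of j] by (elim exE)
    then show "\<exists>L. L-lipschitz_on K (\<lambda>p. \<sigma> (misorientation (fst p) j) *\<^sub>R ((x j - snd p) /\<^sub>R norm (x j - snd p)))"
      by (rule lipschitz_on_scaleR_compact[OF K])
  qed simp
  from 1 2 show ?thesis
    unfolding S_field_def case_prod_beta by (elim exE) (rule exI, erule (1) lipschitz_on_Pair)
qed

section \<open>Uniqueness, local existence and maximal continuation for (S)\<close>

text \<open>Up to time \<open>t\<close> both trajectories trace compact sets avoiding every x j, and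
  the field is Lipschitz on their union. The two lifetimes may differ, as needed for gluing.\<close>

lemma solves_S_unique:
  assumes lip: "\<And>C. compact C \<Longrightarrow> \<exists>M. M-lipschitz_on C \<sigma>" "\<And>C. compact C \<Longrightarrow> \<exists>M. M-lipschitz_on C \<sigma>\<^sub>\<theta>"
    and 1: "solves_S \<sigma> \<sigma>\<^sub>\<theta> x \<alpha>\<^sub>0 a\<^sub>0 T\<^sub>1 \<alpha> a" and 2: "solves_S \<sigma> \<sigma>\<^sub>\<theta> x \<alpha>\<^sub>0 a\<^sub>0 T\<^sub>2 \<beta> b"
    and t: "t \<in> time_interval T\<^sub>1" "t \<in> time_interval T\<^sub>2"
  shows "(\<alpha> t, a t) = (\<beta> t, b t)"
proof -
  let ?F = "S_field \<sigma> \<sigma>\<^sub>\<theta> x" and ?u = "\<lambda>s. (\<alpha> s, a s)" and ?v = "\<lambda>s. (\<beta> s, b s)"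
  have sub: "{0..t} \<subseteq> time_interval T\<^sub>1" "{0..t} \<subseteq> time_interval T\<^sub>2"
    using t by (auto simp: time_interval_def intro: le_less_trans[of _ "ereal t"])
  have deriv: "(?u has_vector_derivative ?F (?u s)) (at s within {0..t})"
    "(?v has_vector_derivative ?F (?v s)) (at s within {0..t})" if "s \<in> {0..t}" for s
    using 1 2 sub that unfolding solves_S_iff
    by (blast intro: has_vector_derivative_within_subset)+
  define K where "K = ?u ` {0..t} \<union> ?v ` {0..t}"
  have "compact K"
    unfolding K_def using deriv
    by (intro compact_Un compact_continuous_image continuous_on_vector_derivative compact_Icc) auto
  moreover have "snd p \<notin> range x" if "p \<in> K" for p
    using that 1 2 sub unfolding solves_S_iff K_def by fastforce
  ultimately obtain L where L: "L-lipschitz_on K ?F"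
    using S_field_lipschitz[OF lip] by meson
  show ?thesis
  proof (rule ode_unique[OF L])
    show "?u 0 = ?v 0" using 1 2 by (simp add: solves_S_iff)
    show "0 \<le> t" using t by (simp add: time_interval_def)
  qed (use deriv in \<open>auto simp: K_def\<close>)
qed

text \<open>\<open>r\<^sub>1\<close> and \<open>r\<^sub>2\<close> are the radii of the balls for the
  orientations and the junction. The last two hypotheses say that maximal speed times
  \<open>T\<close> does not exceed the radius, and \<open>near\<close> keeps the junction ball
  inside the region of the required bound. Misorientations are at most twice the norm of the
  orientation vector, hence the range on which \<sigma> and its derivative are bounded.\<close>

lemma bounded_solution_exists:
  assumes lip: "\<And>C. compact C \<Longrightarrow> \<exists>M. M-lipschitz_on C \<sigma>" "\<And>C. compact C \<Longrightarrow> \<exists>M. M-lipschitz_on C \<sigma>\<^sub>\<theta>"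
    and r: "0 \<le> r\<^sub>1" "0 \<le> r\<^sub>2" and T: "0 < T"
    and near: "\<And>j. norm (a\<^sub>0 - a_inf) + r\<^sub>2 < norm (x j - a_inf)"
    and M\<^sub>0: "\<And>\<theta>. \<bar>\<theta>\<bar> \<le> 2 * (norm \<alpha>\<^sub>0 + r\<^sub>1) \<Longrightarrow> \<bar>\<sigma> \<theta>\<bar> \<le> M\<^sub>0"
    and M\<^sub>1: "\<And>\<theta>. \<bar>\<theta>\<bar> \<le> 2 * (norm \<alpha>\<^sub>0 + r\<^sub>1) \<Longrightarrow> \<bar>\<sigma>\<^sub>\<theta> \<theta>\<bar> \<le> M\<^sub>1"
    and T\<^sub>1: "4 * M\<^sub>1 * (\<Sum>j\<in>UNIV. norm (x j - a_inf)) * T \<le> r\<^sub>1" and T\<^sub>2: "3 * M\<^sub>0 * T \<le> r\<^sub>2"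
  shows "\<exists>\<alpha> a. bounded_solution \<sigma> \<sigma>\<^sub>\<theta> x a_inf \<alpha>\<^sub>0 a\<^sub>0 (ereal T) \<alpha> a"
proof -
  define F where "F = S_field \<sigma> \<sigma>\<^sub>\<theta> x"
  define B where "B = (\<lambda>j. norm (x j - a_inf))"
  define K where "K = cball \<alpha>\<^sub>0 r\<^sub>1 \<times> cball a\<^sub>0 r\<^sub>2"
  have M: "0 \<le> M\<^sub>0" "0 \<le> M\<^sub>1" using M\<^sub>0[of 0] M\<^sub>1[of 0] r by auto
  have near_inf: "norm (a - a_inf) < B j" if "a \<in> cball a\<^sub>0 r\<^sub>2" for a j
    using norm_triangle_ineq[of "a - a\<^sub>0" "a\<^sub>0 - a_inf"] that near[of j]
    by (simp add: B_def dist_norm norm_minus_commute)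
  have b_le: "norm (x j - a) \<le> 2 * B j" if "a \<in> cball a\<^sub>0 r\<^sub>2" for a j
    using norm_triangle_ineq4[of "x j - a_inf" "a - a_inf"] near_inf[OF that, of j]
    by (simp add: B_def)
  have away: "a \<notin> range x" if "a \<in> cball a\<^sub>0 r\<^sub>2" for a
    using near_inf[OF that] by (auto simp: B_def)
  have mis: "\<bar>misorientation \<alpha> j\<bar> \<le> 2 * (norm \<alpha>\<^sub>0 + r\<^sub>1)" if "\<alpha> \<in> cball \<alpha>\<^sub>0 r\<^sub>1" for \<alpha> j
  proof -
    have "\<bar>misorientation \<alpha> j\<bar> \<le> \<bar>\<alpha> $ (j - 1)\<bar> + \<bar>\<alpha> $ j\<bar>"
      unfolding misorientation_def by (rule abs_triangle_ineq4)
    also have "\<dots> \<le> norm \<alpha> + norm \<alpha>"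
      by (intro add_mono component_le_norm_cart)
    also have "\<dots> \<le> 2 * (norm \<alpha>\<^sub>0 + r\<^sub>1)"
      using that norm_triangle_sub[of \<alpha> \<alpha>\<^sub>0] by (simp add: dist_norm norm_minus_commute)
    finally show ?thesis .
  qed
  \<comment> \<open>The factor 4 is 2 from \<open>b_le\<close> times 2, because each index occurs in
    two of the three components, as the summand for j and as the one for j + 1.\<close>
  have F\<^sub>1: "norm (fst (F p)) \<le> 4 * M\<^sub>1 * (\<Sum>j\<in>UNIV. B j)" if pK: "p \<in> K" for p
  proof -
    obtain \<alpha> a where p: "p = (\<alpha>, a)" "\<alpha> \<in> cball \<alpha>\<^sub>0 r\<^sub>1" "a \<in> cball a\<^sub>0 r\<^sub>2"
      using pK by (auto simp: K_def)
    have s: "\<bar>\<sigma>\<^sub>\<theta> (misorientation \<alpha> j) * norm (x j - a)\<bar> \<le> M\<^sub>1 * (2 * B j)" for j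
      unfolding abs_mult using M
      by (intro mult_mono M\<^sub>1 mis p) (auto intro: b_le p)
    have shift: "(\<Sum>j\<in>UNIV. B (j + 1)) = (\<Sum>j\<in>UNIV. B j)" for B :: "3 \<Rightarrow> real"
      by (rule sum.reindex_bij_witness[of _ "\<lambda>j. j - 1" "\<lambda>j. j + 1"]) auto
    have "norm (fst (F p)) \<le> (\<Sum>j\<in>UNIV. \<bar>fst (F p) $ j\<bar>)"
      by (rule norm_le_l1_cart)
    also have "\<dots> \<le> (\<Sum>j\<in>UNIV. M\<^sub>1 * (2 * B (j + 1)) + M\<^sub>1 * (2 * B j))"
    proof (rule sum_mono)
      fix j :: 3
      show "\<bar>fst (F p) $ j\<bar> \<le> M\<^sub>1 * (2 * B (j + 1)) + M\<^sub>1 * (2 * B j)"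
        using s[of j] s[of "j + 1"] by (simp add: F_def S_field_def p(1))
    qed
    also have "\<dots> = 4 * M\<^sub>1 * (\<Sum>j\<in>UNIV. B j)"
      by (simp add: sum.distrib shift flip: sum_distrib_left)
    finally show ?thesis .
  qed
  \<comment> \<open>Three summands, each \<open>M\<^sub>0\<close> times the norm of a normalised
    vector.\<close>
  have F\<^sub>2: "norm (snd (F p)) \<le> 3 * M\<^sub>0" if pK: "p \<in> K" for p
  proof -
    obtain \<alpha> a where p: "p = (\<alpha>, a)" "\<alpha> \<in> cball \<alpha>\<^sub>0 r\<^sub>1" "a \<in> cball a\<^sub>0 r\<^sub>2"
      using pK by (auto simp: K_def)
    have "norm (snd (F p)) \<le> (\<Sum>j\<in>(UNIV :: 3 set). M\<^sub>0 * 1)"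
      unfolding F_def S_field_def p(1) split_conv snd_conv
    proof (rule sum_norm_le)
      fix j :: 3
      have "\<bar>\<sigma> (misorientation \<alpha> j)\<bar> * norm ((x j - a) /\<^sub>R norm (x j - a)) \<le> M\<^sub>0 * 1"
        using M by (intro mult_mono M\<^sub>0 mis p) (auto simp: divide_simps)
      then show "norm (\<sigma> (misorientation \<alpha> j) *\<^sub>R ((x j - a) /\<^sub>R norm (x j - a))) \<le> M\<^sub>0 * 1"
        by (simp only: norm_scaleR[of "\<sigma> _"])
    qed
    then show ?thesis by simp
  qed
  have "compact K" by (auto simp: K_def intro: compact_Times)
  moreover have "snd p \<notin> range x" if "p \<in> K" for p
    using that away[of "snd p"] by (simp add: K_def mem_Times_iff)
  ultimately obtain L where L: "L-lipschitz_on K F"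
    unfolding F_def using S_field_lipschitz[OF lip] by meson
  have K: "convex K" "closed K" "(\<alpha>\<^sub>0, a\<^sub>0) \<in> K"
    using r \<open>compact K\<close> by (auto simp: K_def convex_Times compact_imp_closed)
  have ne: "K \<noteq> {}" using K by blast
  obtain u where u0: "u 0 = (\<alpha>\<^sub>0, a\<^sub>0)" and u: "\<And>t. t \<in> {0..T} \<Longrightarrow>
      (u has_vector_derivative F (closest_point K (u t))) (at t within {0..T})"
    using projected_picard[OF L K(1,2) ne, of T "(\<alpha>\<^sub>0, a\<^sub>0)"] T by auto
  have cp: "closest_point K q \<in> K" for q
    using K ne by (intro closest_point_in_set)
  \<comment> \<open>The speed bounds are evaluated at the projected point, which lies in
    \<open>K\<close> wherever \<open>u t\<close> is, so no continuation argument is needed.\<close>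
  have uK: "u t \<in> K" if t: "t \<in> {0..T}" for t
  proof -
    have "norm (fst (u t) - fst (u 0)) \<le> 4 * M\<^sub>1 * (\<Sum>j\<in>UNIV. B j) * t"
      by (rule norm_increment_le[OF bounded_linear.has_vector_derivative[OF bounded_linear_fst u] _ t])
        (auto intro: F\<^sub>1 cp)
    also have "\<dots> \<le> 4 * M\<^sub>1 * (\<Sum>j\<in>UNIV. B j) * T"
      using t M by (intro mult_left_mono mult_nonneg_nonneg sum_nonneg) (auto simp: B_def)
    also have "\<dots> \<le> r\<^sub>1" using T\<^sub>1 by (simp add: B_def)
    finally have 1: "fst (u t) \<in> cball \<alpha>\<^sub>0 r\<^sub>1" by (simp add: u0 dist_norm norm_minus_commute)
    have "norm (snd (u t) - snd (u 0)) \<le> 3 * M\<^sub>0 * t"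
      by (rule norm_increment_le[OF bounded_linear.has_vector_derivative[OF bounded_linear_snd u] _ t])
        (auto intro: F\<^sub>2 cp)
    also have "\<dots> \<le> 3 * M\<^sub>0 * T"
      using t M by (intro mult_left_mono) auto
    also have "\<dots> \<le> r\<^sub>2" by (rule T\<^sub>2)
    finally have 2: "snd (u t) \<in> cball a\<^sub>0 r\<^sub>2" by (simp add: u0 dist_norm norm_minus_commute)
    show ?thesis using 1 2 by (simp add: K_def mem_Times_iff)
  qed
  have sub: "time_interval (ereal T) \<subseteq> {0..T}" by (auto simp: time_interval_def)
  have "bounded_solution \<sigma> \<sigma>\<^sub>\<theta> x a_inf \<alpha>\<^sub>0 a\<^sub>0 (ereal T) (\<lambda>t. fst (u t)) (\<lambda>t. snd (u t))"
    unfolding bounded_solution_def solves_S_iff prod.collapse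
  proof (intro conjI ballI allI)
    fix t assume "t \<in> time_interval (ereal T)"
    then have t: "t \<in> {0..T}" using sub by blast
    have "snd (u t) \<in> cball a\<^sub>0 r\<^sub>2" using uK[OF t] by (auto simp: K_def)
    then show "snd (u t) \<notin> range x" "norm (snd (u t) - a_inf) < norm (x j - a_inf)" for j
      using away near_inf unfolding B_def by blast+
    \<comment> \<open>Since \<open>u\<close> stays in \<open>K\<close>, the projection acts on it as
      the identity and the original equation holds.\<close>
    have "(u has_vector_derivative F (u t)) (at t within {0..T})"
      using u[OF t] closest_point_self[OF uK[OF t]] by simp
    then show "(u has_vector_derivative S_field \<sigma> \<sigma>\<^sub>\<theta> x (u t)) (at t within time_interval (ereal T))"
      unfolding F_def using sub by (rule has_vector_derivative_within_subset)
  qed (simp_all add: u0)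
  then show ?thesis by blast
qed

text \<open>Every time before the supremum lies in the lifetime of some solution, and uniqueness
  makes the values independent of which solution is used. The supremum may be infinite.\<close>

lemma max_existence_time_attained:
  assumes lip: "\<And>C. compact C \<Longrightarrow> \<exists>M. M-lipschitz_on C \<sigma>" "\<And>C. compact C \<Longrightarrow> \<exists>M. M-lipschitz_on C \<sigma>\<^sub>\<theta>"
    and ex: "0 < T" "\<exists>\<alpha> a. bounded_solution \<sigma> \<sigma>\<^sub>\<theta> x a_inf \<alpha>\<^sub>0 a\<^sub>0 T \<alpha> a"
  shows "\<exists>\<alpha> a. bounded_solution \<sigma> \<sigma>\<^sub>\<theta> x a_inf \<alpha>\<^sub>0 a\<^sub>0
      (max_existence_time \<sigma> \<sigma>\<^sub>\<theta> x a_inf \<alpha>\<^sub>0 a\<^sub>0) \<alpha> a"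
proof -
  define S where "S = {T. 0 < T \<and> (\<exists>\<alpha> a. bounded_solution \<sigma> \<sigma>\<^sub>\<theta> x a_inf \<alpha>\<^sub>0 a\<^sub>0 T \<alpha> a)}"
  define Tm where "Tm = max_existence_time \<sigma> \<sigma>\<^sub>\<theta> x a_inf \<alpha>\<^sub>0 a\<^sub>0"
  have Tm: "Tm = Sup S" by (simp add: Tm_def S_def max_existence_time_def)
  \<comment> \<open>Both components are packed into one function so that a single choice selects the
    solution for each lifetime.\<close>
  have "\<forall>T\<in>S. \<exists>v. bounded_solution \<sigma> \<sigma>\<^sub>\<theta> x a_inf \<alpha>\<^sub>0 a\<^sub>0 T (\<lambda>t. fst (v t)) (\<lambda>t. snd (v t))"
  proof
    fix T assume "T \<in> S"
    then obtain \<alpha> a where "bounded_solution \<sigma> \<sigma>\<^sub>\<theta> x a_inf \<alpha>\<^sub>0 a\<^sub>0 T \<alpha> a" by (auto simp: S_def)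
    then show "\<exists>v. bounded_solution \<sigma> \<sigma>\<^sub>\<theta> x a_inf \<alpha>\<^sub>0 a\<^sub>0 T (\<lambda>t. fst (v t)) (\<lambda>t. snd (v t))"
      by (intro exI[of _ "\<lambda>t. (\<alpha> t, a t)"]) simp
  qed
  then obtain v where v: "\<And>T. T \<in> S \<Longrightarrow>
      bounded_solution \<sigma> \<sigma>\<^sub>\<theta> x a_inf \<alpha>\<^sub>0 a\<^sub>0 T (\<lambda>t. fst (v T t)) (\<lambda>t. snd (v T t))"
    unfolding bchoice_iff by blast
  have "\<forall>t\<in>time_interval Tm. \<exists>T\<in>S. t \<in> time_interval T"
    by (auto simp: Tm time_interval_def less_Sup_iff)
  then obtain pick where pick: "\<And>t. t \<in> time_interval Tm \<Longrightarrow> pick t \<in> S \<and> t \<in> time_interval (pick t)"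
    unfolding Bex_def bchoice_iff by blast
  define u where "u = (\<lambda>t. v (pick t) t)"
  have sub: "time_interval T \<subseteq> time_interval Tm" if "T \<in> S" for T
    using Sup_upper[OF that] by (auto simp: Tm time_interval_def)
  have u_eq: "u t = v T t" if "T \<in> S" "t \<in> time_interval T" for T t
  proof -
    have p: "pick t \<in> S" "t \<in> time_interval (pick t)" using pick sub that by blast+
    from solves_S_unique[OF lip _ _ p(2) that(2)] v[OF p(1)] v[OF that(1)]
    have "(fst (v (pick t) t), snd (v (pick t) t)) = (fst (v T t), snd (v T t))"
      unfolding bounded_solution_def by blast
    then show ?thesis by (simp add: u_def prod_eq_iff)
  qed
  have "bounded_solution \<sigma> \<sigma>\<^sub>\<theta> x a_inf \<alpha>\<^sub>0 a\<^sub>0 Tm (\<lambda>t. fst (u t)) (\<lambda>t. snd (u t))"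
    unfolding bounded_solution_def solves_S_iff prod.collapse
  proof (intro conjI ballI allI)
    have "T \<in> S" "0 \<in> time_interval T" using ex by (auto simp: S_def time_interval_def zero_ereal_def)
    then show "fst (u 0) = \<alpha>\<^sub>0" "snd (u 0) = a\<^sub>0"
      using v[of T] u_eq[of T 0] by (simp_all add: bounded_solution_def solves_S_iff)
    fix t assume t: "t \<in> time_interval Tm"
    define P where "P = pick t"
    have P: "P \<in> S" "t \<in> time_interval P" using pick[OF t] by (simp_all add: P_def)
    have vP: "snd (v P t) \<notin> range x" "norm (snd (v P t) - a_inf) < norm (x j - a_inf)"
      "(v P has_vector_derivative S_field \<sigma> \<sigma>\<^sub>\<theta> x (v P t)) (at t within time_interval P)" for j
      using v[OF P(1)] P(2) by (simp_all add: bounded_solution_def solves_S_iff)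
    show "snd (u t) \<notin> range x" "norm (snd (u t) - a_inf) < norm (x j - a_inf)" for j
      using vP u_eq[OF P] by simp_all
    \<comment> \<open>The two time intervals agree on this open neighbourhood of \<open>t\<close>,
      so the derivatives within them coincide; at t = 0 both remain one-sided.\<close>
    have "open {s. ereal s < P}"
      by (intro open_Collect_less continuous_intros)
    then have "at t within time_interval P = at t within time_interval Tm"
      by (rule at_within_nhd[rotated]) (use sub[OF P(1)] P(2) in \<open>auto simp: time_interval_def\<close>)
    moreover have "(u has_vector_derivative S_field \<sigma> \<sigma>\<^sub>\<theta> x (u t)) (at t within time_interval P)"
      unfolding u_eq[OF P] by (rule has_vector_derivative_transform[OF P(2) _ vP(3)]) (rule u_eq[OF P(1)])
    ultimately show "(u has_vector_derivative S_field \<sigma> \<sigma>\<^sub>\<theta> x (u t)) (at t within time_interval Tm)"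
      by simp
  qed
  then show ?thesis unfolding Tm_def by blast
qed

section \<open>The suprema in the existence time bound\<close>

text \<open>Continuity on a compact interval supplies the upper bound without which a real-valued
  supremum carries no information.\<close>

lemma abs_le_sup_abs:
  assumes "continuous_on UNIV f" "\<bar>\<theta>\<bar> \<le> R"
  shows "\<bar>f \<theta>\<bar> \<le> sup_abs f R"
proof -
  have "{\<theta>. \<bar>\<theta>\<bar> \<le> R} = {-R..R}" by auto
  then have "compact ((\<lambda>\<theta>. \<bar>f \<theta>\<bar>) ` {\<theta>. \<bar>\<theta>\<bar> \<le> R})"
    by (auto intro!: compact_continuous_image continuous_intros continuous_on_subset[OF assms(1)])
  then show ?thesis
    unfolding sup_abs_def using assms(2)
    by (intro cSUP_upper bounded_imp_bdd_above compact_imp_bounded) auto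
qed

text \<open>The Lipschitz constant on [-R, R] bounds the quotients above, and the diagonal pair (0,
  0) contributes the value 0.\<close>

lemma sup_diff_quotient_nonneg:
  assumes lip: "\<And>C. compact C \<Longrightarrow> \<exists>M. M-lipschitz_on C f" and R: "0 \<le> R"
  shows "0 \<le> sup_diff_quotient f R"
proof -
  obtain M where M: "M-lipschitz_on {-R..R} f" using lip compact_Icc by blast
  let ?A = "{(\<theta>\<^sub>1, \<theta>\<^sub>2). \<bar>\<theta>\<^sub>1\<bar> \<le> R \<and> \<bar>\<theta>\<^sub>2\<bar> \<le> R}"
  let ?q = "\<lambda>(\<theta>\<^sub>1, \<theta>\<^sub>2). \<bar>f \<theta>\<^sub>1 - f \<theta>\<^sub>2\<bar> / \<bar>\<theta>\<^sub>1 - \<theta>\<^sub>2\<bar>"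
  have "?q p \<le> M" if pA: "p \<in> ?A" for p
  proof -
    obtain s t where p: "p = (s, t)" "\<bar>s\<bar> \<le> R" "\<bar>t\<bar> \<le> R" using pA by auto
    then have "\<bar>f s - f t\<bar> \<le> M * \<bar>s - t\<bar>"
      using lipschitz_onD[OF M, of s t] by (simp add: dist_real_def abs_le_iff)
    then show ?thesis
      using lipschitz_on_nonneg[OF M] by (cases "s = t") (simp_all add: p(1) divide_le_eq)
  qed
  then have "bdd_above (?q ` ?A)" by (intro bdd_aboveI2)
  then have "?q (0, 0) \<le> sup_diff_quotient f R"
    unfolding sup_diff_quotient_def using R by (intro cSUP_upper) auto
  then show ?thesis by simp
qed

section \<open>Existence and the lower bound for the maximal time\<close>

theorem theorem4p1:
  fixes \<sigma> \<sigma>\<^sub>\<theta> :: "real \<Rightarrow> real"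
    and x :: "3 \<Rightarrow> real ^ 2" and a\<^sub>0 a_inf :: "real ^ 2" and \<alpha>\<^sub>0 :: "real ^ 3"
  assumes "\<And>\<theta>. \<sigma> \<theta> \<ge> 0"
    and "\<And>\<theta>. (\<sigma> has_real_derivative \<sigma>\<^sub>\<theta> \<theta>) (at \<theta>)"
    and "continuous_on UNIV \<sigma>\<^sub>\<theta>"
    and "local_lipschitz (UNIV :: real set) UNIV (\<lambda>_. \<sigma>\<^sub>\<theta>)"
    and "\<exists>C\<^sub>1>0. \<forall>\<theta>. \<sigma> \<theta> \<ge> C\<^sub>1"
    and "\<And>\<theta>. \<sigma>\<^sub>\<theta> \<theta> * \<theta> \<ge> 0"
    and "\<And>\<theta>. \<sigma>\<^sub>\<theta> \<theta> = 0 \<longleftrightarrow> \<theta> = 0"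
    and "\<And>i. norm (\<Sum>j\<in>UNIV - {i}. (x j - x i) /\<^sub>R norm (x j - x i)) > 1"
    and "\<And>j. a_inf \<noteq> x j"
    and "(\<Sum>j\<in>UNIV. (x j - a_inf) /\<^sub>R norm (x j - a_inf)) = 0"
    and "\<And>j. norm (a\<^sub>0 - a_inf) < 1 / 2 * norm (x j - a_inf)"
  shows "\<exists>T_max \<alpha> a.
           T_max = max_existence_time \<sigma> \<sigma>\<^sub>\<theta> x a_inf \<alpha>\<^sub>0 a\<^sub>0 \<and>
           T_max > 0 \<and>
           solves_S \<sigma> \<sigma>\<^sub>\<theta> x \<alpha>\<^sub>0 a\<^sub>0 T_max \<alpha> a \<and>
           (\<forall>t \<in> time_interval T_max. \<forall>j. norm (a t - a_inf) < norm (x j - a_inf)) \<and>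
           T_max \<ge> existence_time_bound \<sigma> \<sigma>\<^sub>\<theta> x a_inf \<alpha>\<^sub>0 a\<^sub>0"
proof -
  let ?B = "\<lambda>j. norm (x j - a_inf)" and ?R = "norm \<alpha>\<^sub>0" and ?e = "norm (a\<^sub>0 - a_inf)"
  let ?Tm = "max_existence_time \<sigma> \<sigma>\<^sub>\<theta> x a_inf \<alpha>\<^sub>0 a\<^sub>0"
    and ?bound = "existence_time_bound \<sigma> \<sigma>\<^sub>\<theta> x a_inf \<alpha>\<^sub>0 a\<^sub>0"
  note deriv = assms(2) and cont' = assms(3) and loc = assms(4) and half = assms(11)
  have lip: "\<exists>M. M-lipschitz_on C \<sigma>" if "compact C" for C
    using deriv cont' that by (rule lipschitz_on_compact_deriv)
  have lip': "\<exists>M. M-lipschitz_on C \<sigma>\<^sub>\<theta>" if "compact C" for C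
  proof -
    \<comment> \<open>The derivative of \<sigma> is viewed as constant in a fictitious time, here
      restricted to the compact set {0}.\<close>
    have "local_lipschitz {0 :: real} C (\<lambda>_. \<sigma>\<^sub>\<theta>)"
      by (rule local_lipschitz_subset[OF loc]) auto
    from local_lipschitz_compact_implies_lipschitz[OF this that compact_sing]
    show ?thesis by (metis continuous_on_const singletonI)
  qed
  have cont: "continuous_on UNIV \<sigma>"
    using deriv by (auto intro: DERIV_continuous_on)
  have B: "0 < ?B j" for j
    using assms(9)[of j] by simp
  have le_Tm: "ereal T \<le> ?Tm" if "0 < T" "\<exists>\<alpha> a. bounded_solution \<sigma> \<sigma>\<^sub>\<theta> x a_inf \<alpha>\<^sub>0 a\<^sub>0 (ereal T) \<alpha> a" for T
    unfolding max_existence_time_def using that by (intro Sup_upper) auto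
  \<comment> \<open>\<open>R\<close> is a variable tied by an equation so that both
    \<open>2 * (?R + 1)\<close> and \<open>4 * ?R\<close> fit.\<close>
  have ex: "\<exists>\<alpha> a. bounded_solution \<sigma> \<sigma>\<^sub>\<theta> x a_inf \<alpha>\<^sub>0 a\<^sub>0 (ereal T) \<alpha> a"
    if "0 \<le> r\<^sub>1" "0 \<le> r\<^sub>2" "0 < T" "\<And>j. ?e + r\<^sub>2 < ?B j" "R = 2 * (?R + r\<^sub>1)"
      "4 * sup_abs \<sigma>\<^sub>\<theta> R * (\<Sum>j\<in>UNIV. ?B j) * T \<le> r\<^sub>1" "3 * sup_abs \<sigma> R * T \<le> r\<^sub>2"
    for r\<^sub>1 r\<^sub>2 T R
    by (rule bounded_solution_exists[OF lip lip' that(1-4) _ _ that(6,7)])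
      (auto intro!: abs_le_sup_abs cont cont' simp: that(5))
  \<comment> \<open>Some positive lifetime is secured first, because the claimed bound can be 0.
    Radius 1 serves for the orientations.\<close>
  obtain T where T: "0 < T" "\<exists>\<alpha> a. bounded_solution \<sigma> \<sigma>\<^sub>\<theta> x a_inf \<alpha>\<^sub>0 a\<^sub>0 (ereal T) \<alpha> a"
  proof -
    \<comment> \<open>Half the least distance fits, as the initial junction is closer to
      \<open>a_inf\<close> than half of every distance.\<close>
    define r\<^sub>2 where "r\<^sub>2 = Min (range ?B) / 2"
    have "Min (range ?B) \<in> range ?B" by (rule Min_in) auto
    then have "0 < Min (range ?B)" using B by auto
    then have r\<^sub>2: "0 < r\<^sub>2" by (simp add: r\<^sub>2_def)
    have near: "?e + r\<^sub>2 < ?B j" for j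
    proof -
      have "Min (range ?B) \<le> ?B j" by (rule Min_le) auto
      then show ?thesis using half[of j] unfolding r\<^sub>2_def by linarith
    qed
    define R where "R = 2 * (?R + 1)"
    \<comment> \<open>The summand 1 here and in \<open>D\<close> keeps the denominators in
      \<open>T\<close> positive even if a supremum is 0.\<close>
    define C where "C = 1 + 4 * sup_abs \<sigma>\<^sub>\<theta> R * (\<Sum>j\<in>UNIV. ?B j)"
    define D where "D = 1 + 3 * sup_abs \<sigma> R"
    have "0 \<le> R" by (simp add: R_def)
    then have "0 \<le> sup_abs \<sigma>\<^sub>\<theta> R" "0 \<le> sup_abs \<sigma> R"
      using abs_le_sup_abs[OF cont', of 0 R] abs_le_sup_abs[OF cont, of 0 R] by auto
    then have CD: "0 < C" "0 < D"
      using B by (auto simp: C_def D_def intro!: add_pos_nonneg mult_nonneg_nonneg sum_nonneg)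
    define T where "T = min (1 / C) (r\<^sub>2 / D)"
    have T: "0 < T" "C * T \<le> 1" "D * T \<le> r\<^sub>2"
      using CD r\<^sub>2 by (auto simp: T_def min_def field_simps)
    show ?thesis
      using T r\<^sub>2 near by (intro that[of T] ex[of 1 r\<^sub>2 T R])
        (auto simp: R_def C_def D_def algebra_simps)
  qed
  have pos: "?Tm > 0"
    using le_Tm[OF T] T(1) by (metis ereal_less(2) less_le_trans)
  have bound: "?bound \<le> ?Tm"
  proof -
    define M\<^sub>0 where "M\<^sub>0 = sup_abs \<sigma> (4 * ?R)"
    define M\<^sub>1 where "M\<^sub>1 = sup_abs \<sigma>\<^sub>\<theta> (4 * ?R)"
    define M\<^sub>2 where "M\<^sub>2 = sup_diff_quotient \<sigma>\<^sub>\<theta> (4 * ?R)"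
    define C where "C = 4 * (M\<^sub>1 + 8 * M\<^sub>2 * ?R) * (\<Sum>j\<in>UNIV. ?B j)"
    have le: "?bound \<le> ereal ?R / ereal C" "?bound \<le> ereal ?e / ereal (3 * M\<^sub>0)"
      unfolding existence_time_bound_def Let_def C_def M\<^sub>0_def M\<^sub>1_def M\<^sub>2_def
      by (intro Min_le; simp)+
    show ?thesis
    proof (cases "?R = 0 \<or> ?e = 0")
      case True
      \<comment> \<open>This includes y = 0, the convention 0 / 0 = 0, so a vanishing numerator
        makes the whole bound at most 0.\<close>
      have "ereal 0 / y = 0" for y by (simp flip: zero_ereal_def)
      with le True have "?bound \<le> 0" by (elim disjE) (simp_all only:)
      then show ?thesis using pos by (meson less_imp_le order_trans)
    next
      case False
      then have R: "0 < ?R" and e: "0 < ?e" by auto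
      have sB: "0 < (\<Sum>j\<in>UNIV. ?B j)" using B by (intro sum_pos) auto
      have "\<bar>\<sigma> 0\<bar> \<le> M\<^sub>0" unfolding M\<^sub>0_def by (rule abs_le_sup_abs[OF cont]) simp
      moreover have "\<sigma> 0 > 0" using assms(5) by (meson less_le_trans)
      ultimately have M\<^sub>0: "0 < M\<^sub>0" by linarith
      \<comment> \<open>The point \<open>?R\<close> is nonzero and lies in the range of the
        supremum, so \<open>M\<^sub>1\<close> is positive. With positive denominators the extended
        quotients are ordinary real ones.\<close>
      have "\<bar>\<sigma>\<^sub>\<theta> ?R\<bar> \<le> M\<^sub>1" unfolding M\<^sub>1_def by (rule abs_le_sup_abs[OF cont']) simp
      moreover have "\<sigma>\<^sub>\<theta> ?R \<noteq> 0" using assms(7)[of ?R] R by simp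
      ultimately have M\<^sub>1: "0 < M\<^sub>1" by linarith
      have M\<^sub>2: "0 \<le> M\<^sub>2" unfolding M\<^sub>2_def by (rule sup_diff_quotient_nonneg[OF lip']) auto
      \<comment> \<open>As \<open>M\<^sub>2\<close> is nonnegative, its term only enlarges
        \<open>C\<close>, which therefore dominates the speed of the orientations.\<close>
      have C_ge: "4 * M\<^sub>1 * (\<Sum>j\<in>UNIV. ?B j) \<le> C"
        unfolding C_def using sB M\<^sub>2 by (intro mult_right_mono) auto
      moreover have "0 < 4 * M\<^sub>1 * (\<Sum>j\<in>UNIV. ?B j)" using sB M\<^sub>1 by simp
      ultimately have C: "0 < C" by linarith
      define T where "T = min (?R / C) (?e / (3 * M\<^sub>0))"
      have T: "0 < T" "T \<le> ?R / C" "T \<le> ?e / (3 * M\<^sub>0)"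
        using R e C M\<^sub>0 by (auto simp: T_def)
      have "4 * M\<^sub>1 * (\<Sum>j\<in>UNIV. ?B j) * T \<le> C * T"
        using C_ge T by (intro mult_right_mono) auto
      also have "\<dots> \<le> ?R" using T C by (simp add: pos_le_divide_eq mult.commute)
      finally have T\<^sub>1: "4 * M\<^sub>1 * (\<Sum>j\<in>UNIV. ?B j) * T \<le> ?R" .
      have T\<^sub>2: "3 * M\<^sub>0 * T \<le> ?e" using T M\<^sub>0 by (simp add: pos_le_divide_eq mult.commute)
      \<comment> \<open>The radii are \<open>?R\<close> and \<open>?e\<close>: misorientations then
        range up to 4 \<open>?R\<close>, matching the suprema, and 2 \<open>?e\<close> stays below
        every distance by the factor 1/2 in the hypothesis.\<close>
      have "ereal T \<le> ?Tm"
      proof (rule le_Tm[OF T(1)], rule ex)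
        show "?e + ?e < ?B j" for j using half[of j] by simp
        show "4 * ?R = 2 * (?R + ?R)" by simp
      qed (use T T\<^sub>1 T\<^sub>2 in \<open>simp_all add: M\<^sub>0_def M\<^sub>1_def\<close>)
      moreover have "?bound \<le> ereal T"
        using le C M\<^sub>0 by (simp add: T_def min_def)
      ultimately show ?thesis by (rule order_trans[rotated])
    qed
  qed
  have "0 < ereal T" using T by simp
  with max_existence_time_attained[OF lip lip' this T(2)] pos bound show ?thesis
    unfolding bounded_solution_def by blast
qed

end
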